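(* Let $k\ge3$, let $N_1,\dots,N_k\ge1$ be integers, and for $1\le i<j\le k$ let $\theta_{ij}:[N_i]\times[N_j]\to[N_j]\times[N_i]$ be a bijection; put $\theta=\{\theta_{ij}:1\le i<j\le k\}$. Let $X=\bigsqcup_{i=1}^k[N_i]$ (disjoint union) and define a bijection $R:X^2\to X^2$ by $$R|_{[N_i]^2}=\mathrm{id}_{[N_i]^2}\ (1\le i\le k),\qquad R|_{[N_i]\times[N_j]}=\theta_{ij},\qquad R|_{[N_j]\times[N_i]}=\theta_{ij}^{-1}\ (1\le i<j\le k).$$ Then $\theta$ determines a (single-vertex) $k$-graph $\mathbb{F}_\theta^+$ if and only if $R$ is a solution of the Yang–Baxter equation on $\bigsqcup_{i=1}^k[N_i]$. Furthermore, the following properties hold: - $\mathbb{F}_\theta^+\cong G_R^+$; - $R$ is involutive and square-free; - $R$ is degenerate unless $N_i=1$ for all $1\le i\le k$.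
   Context: $[N]=\{1,\dots,N\}$, and $\mathbb{N}$ denotes the non-negative integers. A bijection $R:X^2\to X^2$ is a (set-theoretic) solution of the Yang–Baxter equation on $X$ if $R_{12}R_{23}R_{12}=R_{23}R_{12}R_{23}$ on $X^3$, where $R_{12}=R\times\mathrm{id}_X$, $R_{23}=\mathrm{id}_X\times R$. $R$ is involutive if $R^2=\mathrm{id}_{X^2}$; square-free if $R(x,x)=(x,x)$ for all $x\in X$; and, writing $R(x,y)=(u,v)$, non-degenerate if $x\mapsto v$ is bijective for each fixed $y$ and $y\mapsto u$ is bijective for each fixed $x$; degenerate means not non-degenerate. The YB-semigroup $G_R^+$ is the unital semigroup generated by $X$ with relations $xy=y'x'$ whenever $R(x,y)=(y',x')$. A $k$-graph is a countable small category $\Lambda$ with a degree functor $d:\Lambda\to\mathbb{N}^k$ having the factorization property: whenever $d(\lambda)=\mathbf m+\mathbf n$ there are unique $\mu,\nu$ with $d(\mu)=\mathbf m$, $d(\nu)=\mathbf n$ and $\lambda=\mu\nu$. It is single-vertex if it has one object. $\mathbb{F}_\theta^+$ is the unital semigroup generated by $e^i_{\mathfrak s}$ ($1\le i\le k$, $\mathfrak s\in[N_i]$) subject to $e^i_{\mathfrak s}e^j_{\mathfrak t}=e^j_{\mathfrak t'}e^i_{\mathfrak s'}$ whenever $1\le i<j\le k$ and $\theta_{ij}(\mathfrak s,\mathfrak t)=(\mathfrak t',\mathfrak s')$; its degree homomorphism $d:\mathbb{F}_\theta^+\to\mathbb{N}^k$ sends $e^i_{\mathfrak s}$ to the $i$th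 standard basis vector. "$\theta$ determines a $k$-graph $\mathbb{F}_\theta^+$" means that $(\mathbb{F}_\theta^+,d)$ has the factorization property. The isomorphism $\mathbb{F}_\theta^+\cong G_R^+$ is one of unital semigroups. *)

theory Defs
  imports "HOL-Algebra.Group" "HOL-Library.Countable_Set"
begin

section \<open>Monoids given by generators and relations\<close>

text \<open>The congruence on the free monoid of words over \<open>X\<close> generated by \<open>rels\<close>.\<close>

inductive_set word_cong :: "'a set \<Rightarrow> ('a list \<times> 'a list) set \<Rightarrow> ('a list \<times> 'a list) set"
  for X :: "'a set" and rels :: "('a list \<times> 'a list) set"
where
  rel: "\<lbrakk>(u, v) \<in> rels; u \<in> lists X; v \<in> lists X; a \<in> lists X; b \<in> lists X\<rbrakk>
          \<Longrightarrow> (a @ u @ b, a @ v @ b) \<in> word_cong X rels"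
| refl: "w \<in> lists X \<Longrightarrow> (w, w) \<in> word_cong X rels"
| sym: "(u, v) \<in> word_cong X rels \<Longrightarrow> (v, u) \<in> word_cong X rels"
| trans: "\<lbrakk>(u, v) \<in> word_cong X rels; (v, w) \<in> word_cong X rels\<rbrakk> \<Longrightarrow> (u, w) \<in> word_cong X rels"

definition presented_monoid :: "'a set \<Rightarrow> ('a list \<times> 'a list) set \<Rightarrow> 'a list set monoid" where
  "presented_monoid X rels =
     \<lparr>carrier = lists X // word_cong X rels,
      mult = (\<lambda>A B. \<Union>u\<in>A. \<Union>v\<in>B. word_cong X rels `` {u @ v}),
      one = word_cong X rels `` {[]}\<rparr>"


section \<open>Set-theoretic solutions of the Yang--Baxter equation\<close>

definition act12 :: "('a \<times> 'a \<Rightarrow> 'a \<times> 'a) \<Rightarrow> 'a \<times> 'a \<times> 'a \<Rightarrow> 'a \<times> 'a \<times> 'a" where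
  "act12 R = (\<lambda>(x, y, z). case R (x, y) of (u, v) \<Rightarrow> (u, v, z))"

definition act23 :: "('a \<times> 'a \<Rightarrow> 'a \<times> 'a) \<Rightarrow> 'a \<times> 'a \<times> 'a \<Rightarrow> 'a \<times> 'a \<times> 'a" where
  "act23 R = (\<lambda>(x, y, z). case R (y, z) of (u, v) \<Rightarrow> (x, u, v))"

definition yb_solution :: "'a set \<Rightarrow> ('a \<times> 'a \<Rightarrow> 'a \<times> 'a) \<Rightarrow> bool" where
  "yb_solution X R \<longleftrightarrow>
     bij_betw R (X \<times> X) (X \<times> X) \<and>
     (\<forall>p \<in> X \<times> X \<times> X. act12 R (act23 R (act12 R p)) = act23 R (act12 R (act23 R p)))"

definition yb_involutive :: "'a set \<Rightarrow> ('a \<times> 'a \<Rightarrow> 'a \<times> 'a) \<Rightarrow> bool" where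
  "yb_involutive X R \<longleftrightarrow> (\<forall>p \<in> X \<times> X. R (R p) = p)"

definition yb_square_free :: "'a set \<Rightarrow> ('a \<times> 'a \<Rightarrow> 'a \<times> 'a) \<Rightarrow> bool" where
  "yb_square_free X R \<longleftrightarrow> (\<forall>x \<in> X. R (x, x) = (x, x))"

definition yb_nondegenerate :: "'a set \<Rightarrow> ('a \<times> 'a \<Rightarrow> 'a \<times> 'a) \<Rightarrow> bool" where
  "yb_nondegenerate X R \<longleftrightarrow>
     (\<forall>y \<in> X. bij_betw (\<lambda>x. snd (R (x, y))) X X) \<and>
     (\<forall>x \<in> X. bij_betw (\<lambda>y. fst (R (x, y))) X X)"

definition yb_degenerate :: "'a set \<Rightarrow> ('a \<times> 'a \<Rightarrow> 'a \<times> 'a) \<Rightarrow> bool" where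
  "yb_degenerate X R \<longleftrightarrow> \<not> yb_nondegenerate X R"

definition yb_semigroup :: "'a set \<Rightarrow> ('a \<times> 'a \<Rightarrow> 'a \<times> 'a) \<Rightarrow> 'a list set monoid" where
  "yb_semigroup X R =
     presented_monoid X {([x, y], [y', x']) | x y y' x'. x \<in> X \<and> y \<in> X \<and> R (x, y) = (y', x')}"


section \<open>Higher-rank graphs\<close>

record ('o, 'm) small_cat =
  Obj :: "'o set"
  Mor :: "'m set"
  Src :: "'m \<Rightarrow> 'o"
  Rng :: "'m \<Rightarrow> 'o"
  Idm :: "'o \<Rightarrow> 'm"
  Cmp :: "'m \<Rightarrow> 'm \<Rightarrow> 'm"

text \<open>\<^term>\<open>Cmp C f g\<close> is the composite \<open>f g\<close>; it is meaningful only if the source of \<open>f\<close> is the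
  range of \<open>g\<close>.\<close>

locale small_category =
  fixes C :: "('o, 'm) small_cat"
  assumes Src_in: "f \<in> Mor C \<Longrightarrow> Src C f \<in> Obj C"
    and Rng_in: "f \<in> Mor C \<Longrightarrow> Rng C f \<in> Obj C"
    and Idm_in: "v \<in> Obj C \<Longrightarrow> Idm C v \<in> Mor C"
    and Src_Idm: "v \<in> Obj C \<Longrightarrow> Src C (Idm C v) = v"
    and Rng_Idm: "v \<in> Obj C \<Longrightarrow> Rng C (Idm C v) = v"
    and Cmp_in: "\<lbrakk>f \<in> Mor C; g \<in> Mor C; Src C f = Rng C g\<rbrakk> \<Longrightarrow> Cmp C f g \<in> Mor C"
    and Src_Cmp: "\<lbrakk>f \<in> Mor C; g \<in> Mor C; Src C f = Rng C g\<rbrakk> \<Longrightarrow> Src C (Cmp C f g) = Src C g"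
    and Rng_Cmp: "\<lbrakk>f \<in> Mor C; g \<in> Mor C; Src C f = Rng C g\<rbrakk> \<Longrightarrow> Rng C (Cmp C f g) = Rng C f"
    and Cmp_Idm_left: "f \<in> Mor C \<Longrightarrow> Cmp C (Idm C (Rng C f)) f = f"
    and Cmp_Idm_right: "f \<in> Mor C \<Longrightarrow> Cmp C f (Idm C (Src C f)) = f"
    and Cmp_assoc: "\<lbrakk>f \<in> Mor C; g \<in> Mor C; h \<in> Mor C; Src C f = Rng C g; Src C g = Rng C h\<rbrakk>
          \<Longrightarrow> Cmp C (Cmp C f g) h = Cmp C f (Cmp C g h)"

text \<open>The monoid of \<open>k\<close>-tuples of natural numbers, as functions that vanish outside \<open>{1..k}\<close>.\<close>

definition nat_tuples :: "nat \<Rightarrow> (nat \<Rightarrow> nat) set" where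
  "nat_tuples k = {m. \<forall>i. i \<notin> {1..k} \<longrightarrow> m i = 0}"

locale k_graph = small_category \<Lambda> for k :: nat and \<Lambda> :: "('o, 'm) small_cat" +
  fixes d :: "'m \<Rightarrow> nat \<Rightarrow> nat"
  assumes countable_Mor: "countable (Mor \<Lambda>)"
    and deg_in: "l \<in> Mor \<Lambda> \<Longrightarrow> d l \<in> nat_tuples k"
    and deg_Idm: "v \<in> Obj \<Lambda> \<Longrightarrow> d (Idm \<Lambda> v) = (\<lambda>i. 0)"
    and deg_Cmp: "\<lbrakk>f \<in> Mor \<Lambda>; g \<in> Mor \<Lambda>; Src \<Lambda> f = Rng \<Lambda> g\<rbrakk>
          \<Longrightarrow> d (Cmp \<Lambda> f g) = (\<lambda>i. d f i + d g i)"
    and factorization: "\<lbrakk>l \<in> Mor \<Lambda>; m \<in> nat_tuples k; n \<in> nat_tuples k; d l = (\<lambda>i. m i + n i)\<rbrakk>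
          \<Longrightarrow> \<exists>!(f, g). f \<in> Mor \<Lambda> \<and> g \<in> Mor \<Lambda> \<and> Src \<Lambda> f = Rng \<Lambda> g \<and>
                d f = m \<and> d g = n \<and> l = Cmp \<Lambda> f g"

definition single_vertex :: "('o, 'm) small_cat \<Rightarrow> bool" where
  "single_vertex C \<longleftrightarrow> (\<exists>v. Obj C = {v})"

definition one_object_cat :: "'m monoid \<Rightarrow> (unit, 'm) small_cat" where
  "one_object_cat M =
     \<lparr>Obj = {()}, Mor = carrier M, Src = (\<lambda>_. ()), Rng = (\<lambda>_. ()),
      Idm = (\<lambda>_. \<one>\<^bsub>M\<^esub>), Cmp = (\<lambda>f g. f \<otimes>\<^bsub>M\<^esub> g)\<rparr>"


section \<open>The data attached to a family \<open>\<theta>\<close>\<close>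

text \<open>The pair \<open>(i, s)\<close> stands for the element \<open>s\<close> of the \<open>i\<close>-th summand, and for the generator
  \<open>e\<close> with upper index \<open>i\<close> and lower index \<open>s\<close>.\<close>

definition theta_carrier :: "nat \<Rightarrow> (nat \<Rightarrow> nat) \<Rightarrow> (nat \<times> nat) set" where
  "theta_carrier k N = (SIGMA i:{1..k}. {1..N i})"

definition theta_semigroup ::
    "nat \<Rightarrow> (nat \<Rightarrow> nat) \<Rightarrow> (nat \<Rightarrow> nat \<Rightarrow> nat \<times> nat \<Rightarrow> nat \<times> nat) \<Rightarrow> (nat \<times> nat) list set monoid" where
  "theta_semigroup k N \<theta> =
     presented_monoid (theta_carrier k N)
       {([(i, s), (j, t)], [(j, t'), (i, s')]) | i j s t t' s'.
          1 \<le> i \<and> i < j \<and> j \<le> k \<and> s \<in> {1..N i} \<and> t \<in> {1..N j} \<and> \<theta> i j (s, t) = (t', s')}"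

definition word_degree :: "(nat \<times> nat) list \<Rightarrow> nat \<Rightarrow> nat" where
  "word_degree w = (\<lambda>i. count_list (map fst w) i)"

text \<open>The defining relations preserve \<^const>\<open>word_degree\<close>, so its image on a congruence class is
  a singleton.\<close>

definition theta_degree :: "(nat \<times> nat) list set \<Rightarrow> nat \<Rightarrow> nat" where
  "theta_degree c = the_elem (word_degree ` c)"

definition determines_k_graph ::
    "nat \<Rightarrow> (nat \<Rightarrow> nat) \<Rightarrow> (nat \<Rightarrow> nat \<Rightarrow> nat \<times> nat \<Rightarrow> nat \<times> nat) \<Rightarrow> bool" where
  "determines_k_graph k N \<theta> \<longleftrightarrow>
     k_graph k (one_object_cat (theta_semigroup k N \<theta>)) theta_degree \<and>
     single_vertex (one_object_cat (theta_semigroup k N \<theta>))"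

definition theta_R ::
    "(nat \<Rightarrow> nat) \<Rightarrow> (nat \<Rightarrow> nat \<Rightarrow> nat \<times> nat \<Rightarrow> nat \<times> nat) \<Rightarrow>
     (nat \<times> nat) \<times> (nat \<times> nat) \<Rightarrow> (nat \<times> nat) \<times> (nat \<times> nat)" where
  "theta_R N \<theta> = (\<lambda>((i, s), (j, t)).
     if i = j then ((i, s), (j, t))
     else
       let (t', s') =
         (if i < j then \<theta> i j (s, t)
          else inv_into ({1..N j} \<times> {1..N i}) (\<theta> j i) (s, t))
       in ((j, t'), (i, s')))"

end

theory Submission
  imports Defs "HOL-Library.Multiset"
begin

text \<open>
  Call the first component of a letter \<open>(i, s)\<close> its colour. The map \<open>R\<close> attached to \<open>\<theta>\<close> is an
  involution of pairs of letters that exchanges the two colours and fixes pairs of equal colour.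
  A relation \<open>xy = y'x'\<close> of the YB-semigroup is therefore trivial, a relation of
  \<open>\<theta>\<close>, or such a relation read backwards: both presentations generate the same congruence
  on words, and the two monoids coincide. Everything else about the equivalence can be said for an
  arbitrary colour-exchanging involution \<open>R\<close>.

  Existence of factorizations is automatic, because \<open>R\<close> lets a letter move past any other letter
  without changing the colours involved. So the factorization property amounts to uniqueness: if
  \<open>uv\<close> and \<open>u'v'\<close> are congruent and \<open>u\<close>, \<open>u'\<close> as well as \<open>v\<close>, \<open>v'\<close> have the same degree,
  then \<open>u\<close>, \<open>u'\<close> are congruent and so are \<open>v\<close>, \<open>v'\<close>.

  If splitting is unique in this sense, congruent words with the same sequence of colours are equal:
  letters can be split off one at a time, and a one-letter word is congruent only to itself. Both
  sides of the Yang--Baxter equation, applied to \<open>(x, y, z)\<close>, are words congruent to \<open>xyz\<close> whose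
  colours are those of \<open>z\<close>, \<open>y\<close>, \<open>x\<close>. Hence they agree.

  Conversely, suppose that \<open>R\<close> solves the Yang--Baxter equation. Insertion sort by colour, where
  each exchange of neighbours is made with \<open>R\<close>, leads from a word to a congruent word. The
  Yang--Baxter equation says that inserting \<open>y\<close> and then \<open>x\<close> gives the same as inserting \<open>x'\<close> and
  then \<open>y'\<close>, where \<open>R (x, y) = (y', x')\<close> (\<open>insert_letter_exchange\<close>). So the sorted form depends on
  the congruence class only. As every exchange can be undone, the sorted form together with the
  original colours determines the word (\<open>colour_sort_inject\<close>). Given congruent \<open>uv\<close> and \<open>u'v'\<close> as
  above, sort the four factors separately; the resulting products are congruent and have the same
  colours, so they are equal, and cutting them at the same place gives unique splitting.

  Finally, if some colour has two letters, \<open>R\<close> is the identity on their pairs, so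
  \<open>x \<mapsto> snd (R (x, y))\<close> is constant on the letters of the colour of \<open>y\<close>, and \<open>R\<close> is degenerate.
\<close>

section \<open>Congruences and monoids given by generators and relations\<close>

lemma word_cong_in_lists:
  assumes "(u, v) \<in> word_cong X r"
  shows "u \<in> lists X" "v \<in> lists X"
  using assms by (induction) auto

lemma equiv_word_cong: "equiv (lists X) (word_cong X r)"
proof (rule equivI)
  show "word_cong X r \<subseteq> lists X \<times> lists X"
    by (auto dest: word_cong_in_lists)
  show "refl_on (lists X) (word_cong X r)"
    by (rule refl_onI) (rule word_cong.refl)
  show "Relation.sym (word_cong X r)"
    by (rule symI) (rule word_cong.sym)
  show "Relation.trans (word_cong X r)"
    by (rule transI) (rule word_cong.trans)
qed

lemma word_cong_in_context:
  assumes "(u, v) \<in> word_cong X r" "a \<in> lists X" "b \<in> lists X"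
  shows "(a @ u @ b, a @ v @ b) \<in> word_cong X r"
  using assms
proof (induction)
  case (rel u v c e)
  then have "((a @ c) @ u @ (e @ b), (a @ c) @ v @ (e @ b)) \<in> word_cong X r"
    by (intro word_cong.rel) auto
  then show ?case by simp
next
  case (refl w)
  then show ?case by (intro word_cong.refl) auto
next
  case (sym u v)
  then show ?case by (blast intro: word_cong.sym)
next
  case (trans u v w)
  then show ?case by (blast intro: word_cong.trans)
qed

lemma word_cong_append:
  assumes "(u, u') \<in> word_cong X r" "(v, v') \<in> word_cong X r"
  shows "(u @ v, u' @ v') \<in> word_cong X r"
proof -
  have "(u @ v, u' @ v) \<in> word_cong X r"
    using word_cong_in_context[OF assms(1), of "[]" v] word_cong_in_lists[OF assms(2)] by simp
  moreover have "(u' @ v, u' @ v') \<in> word_cong X r"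
    using word_cong_in_context[OF assms(2), of u' "[]"] word_cong_in_lists[OF assms(1)] by simp
  ultimately show ?thesis by (rule word_cong.trans)
qed

lemma word_cong_mono:
  assumes "\<And>u v. \<lbrakk>(u, v) \<in> r; u \<in> lists X; v \<in> lists X\<rbrakk> \<Longrightarrow> (u, v) \<in> word_cong X r'"
  shows "word_cong X r \<subseteq> word_cong X r'"
proof (rule subrelI)
  fix u v assume "(u, v) \<in> word_cong X r"
  then show "(u, v) \<in> word_cong X r'"
  proof (induction)
    case (rel u v a b)
    then show ?case by (intro word_cong_in_context assms)
  qed (auto intro: word_cong.intros(2,3,4))
qed

definition word_class :: "'a set \<Rightarrow> ('a list \<times> 'a list) set \<Rightarrow> 'a list \<Rightarrow> 'a list set" where
  "word_class X r w = word_cong X r `` {w}"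

lemma word_class_eq_iff:
  assumes "u \<in> lists X" "v \<in> lists X"
  shows "word_class X r u = word_class X r v \<longleftrightarrow> (u, v) \<in> word_cong X r"
  unfolding word_class_def using eq_equiv_class_iff[OF equiv_word_cong assms] .

lemma carrier_presented_monoid:
  "carrier (presented_monoid X r) = word_class X r ` lists X"
  by (auto simp: presented_monoid_def word_class_def quotient_def)

lemma one_presented_monoid: "\<one>\<^bsub>presented_monoid X r\<^esub> = word_class X r []"
  by (simp add: presented_monoid_def word_class_def)

lemma mult_presented_monoid:
  assumes "u \<in> lists X" "v \<in> lists X"
  shows "word_class X r u \<otimes>\<^bsub>presented_monoid X r\<^esub> word_class X r v = word_class X r (u @ v)"
proof -
  have "(\<lambda>u v. word_cong X r `` {u @ v}) respects2 word_cong X r"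
    using equiv_word_cong[of X r]
    by (auto intro!: congruent2I' equiv_class_eq[OF equiv_word_cong] word_cong_append)
  from UN_equiv_class2[OF equiv_word_cong equiv_word_cong this assms]
  show ?thesis by (simp add: presented_monoid_def word_class_def)
qed

lemma small_category_presented_monoid:
  "small_category (one_object_cat (presented_monoid X r))"
  by (unfold_locales; simp add: one_object_cat_def carrier_presented_monoid one_presented_monoid
        del: in_lists_conv_set; (elim imageE)?;
      simp add: mult_presented_monoid image_eqI del: in_lists_conv_set)

section \<open>Colour-exchanging involutions\<close>

definition yb_rels :: "'a set \<Rightarrow> ('a \<times> 'a \<Rightarrow> 'a \<times> 'a) \<Rightarrow> ('a list \<times> 'a list) set" where
  "yb_rels X R = {([x, y], [y', x']) | x y y' x'. x \<in> X \<and> y \<in> X \<and> R (x, y) = (y', x')}"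

lemma yb_relsI: "\<lbrakk>x \<in> X; y \<in> X; R (x, y) = (y', x')\<rbrakk> \<Longrightarrow> ([x, y], [y', x']) \<in> yb_rels X R"
  unfolding yb_rels_def by blast

lemma yb_relsE:
  assumes "(u, v) \<in> yb_rels X R"
  obtains x y y' x' where "u = [x, y]" "v = [y', x']" "x \<in> X" "y \<in> X" "R (x, y) = (y', x')"
  using assms unfolding yb_rels_def by blast

lemma yb_semigroup_eq_presented: "yb_semigroup X R = presented_monoid X (yb_rels X R)"
  unfolding yb_semigroup_def yb_rels_def ..

text \<open>The first component of a letter is its colour. These are the only properties of the map
  attached to \<open>\<theta>\<close> that the comparison of factorizations with the Yang--Baxter equation uses.\<close>

locale colour_exchange =
  fixes X :: "(nat \<times> nat) set"
    and R :: "(nat \<times> nat) \<times> (nat \<times> nat) \<Rightarrow> (nat \<times> nat) \<times> (nat \<times> nat)"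
  assumes R_closed: "\<lbrakk>x \<in> X; y \<in> X\<rbrakk> \<Longrightarrow> R (x, y) \<in> X \<times> X"
    and fst_R: "\<lbrakk>x \<in> X; y \<in> X\<rbrakk> \<Longrightarrow> fst (fst (R (x, y))) = fst y"
    and snd_R: "\<lbrakk>x \<in> X; y \<in> X\<rbrakk> \<Longrightarrow> fst (snd (R (x, y))) = fst x"
    and R_R: "\<lbrakk>x \<in> X; y \<in> X\<rbrakk> \<Longrightarrow> R (R (x, y)) = (x, y)"
    and R_same: "\<lbrakk>x \<in> X; y \<in> X; fst x = fst y\<rbrakk> \<Longrightarrow> R (x, y) = (x, y)"
begin

abbreviation cong :: "((nat \<times> nat) list \<times> (nat \<times> nat) list) set" where
  "cong \<equiv> word_cong X (yb_rels X R)"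

abbreviation cls :: "(nat \<times> nat) list \<Rightarrow> (nat \<times> nat) list set" where
  "cls \<equiv> word_class X (yb_rels X R)"

lemma R_cases:
  assumes "x \<in> X" "y \<in> X"
  obtains y' x' where "R (x, y) = (y', x')" "R (y', x') = (x, y)" "y' \<in> X" "x' \<in> X"
    "fst y' = fst y" "fst x' = fst x"
  using R_closed[OF assms] fst_R[OF assms] snd_R[OF assms] R_R[OF assms]
  by (cases "R (x, y)") auto

lemma cong_R:
  assumes "x \<in> X" "y \<in> X" "R (x, y) = (y', x')" "w \<in> lists X"
  shows "(x # y # w, y' # x' # w) \<in> cong"
proof -
  have "y' \<in> X" "x' \<in> X" using R_closed[OF assms(1,2)] assms(3) by auto
  then show ?thesis
    using word_cong.rel[of "[x, y]" "[y', x']" "yb_rels X R" X "[]" w] assms yb_relsI[of x X y R] by simp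
qed

lemma cong_Cons: "\<lbrakk>(u, v) \<in> cong; x \<in> X\<rbrakk> \<Longrightarrow> (x # u, x # v) \<in> cong"
  using word_cong_append[of "[x]" "[x]" X _ u v] word_cong.refl[of "[x]" X] by simp

lemma cong_mset_colours: "(u, v) \<in> cong \<Longrightarrow> mset (map fst u) = mset (map fst v)"
proof (induction rule: word_cong.induct)
  case (rel u v a b)
  obtain x y y' x' where "u = [x, y]" "v = [y', x']" "x \<in> X" "y \<in> X" "R (x, y) = (y', x')"
    using rel(1) by (rule yb_relsE)
  then show ?case using fst_R[of x y] snd_R[of x y] by simp
qed auto

lemma word_degree_eq_iff: "word_degree u = word_degree v \<longleftrightarrow> mset (map fst u) = mset (map fst v)"
  by (auto simp: word_degree_def multiset_eq_iff fun_eq_iff count_mset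
      simp del: mset_map)

lemma cong_word_degree: "(u, v) \<in> cong \<Longrightarrow> word_degree u = word_degree v"
  unfolding word_degree_eq_iff by (rule cong_mset_colours)

text \<open>All members of a congruence class have the same degree, so the image whose element
  \<^const>\<open>theta_degree\<close> picks is a singleton.\<close>

lemma theta_degree_cls: "w \<in> lists X \<Longrightarrow> theta_degree (cls w) = word_degree w"
proof -
  assume w: "w \<in> lists X"
  have "w \<in> cls w" "\<And>v. v \<in> cls w \<Longrightarrow> word_degree v = word_degree w"
    using word_cong.refl[OF w] by (auto simp: word_class_def dest: cong_word_degree)
  then have "word_degree ` cls w = {word_degree w}" by blast
  then show ?thesis by (simp add: theta_degree_def)
qed

text \<open>Relations only rewrite factors of length two, and they preserve length.\<close>

lemma cong_short: "(u, v) \<in> cong \<Longrightarrow> length u \<le> 1 \<Longrightarrow> u = v"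
proof -
  assume "(u, v) \<in> cong"
  then have "length u = length v \<and> (2 \<le> length u \<or> u = v)"
  proof (induction rule: word_cong.induct)
    case (rel u v a b)
    obtain x y y' x' where "u = [x, y]" "v = [y', x']" using rel(1) by (rule yb_relsE)
    then show ?case by simp
  qed auto
  then show "length u \<le> 1 \<Longrightarrow> u = v" by auto
qed

section \<open>Splitting words by degree\<close>

lemma word_degree_simps:
  "word_degree [] = (\<lambda>i. 0)"
  "word_degree (x # w) = (\<lambda>i. (if i = fst x then 1 else 0) + word_degree w i)"
  "word_degree (u @ v) = (\<lambda>i. word_degree u i + word_degree v i)"
  by (auto simp: word_degree_def fun_eq_iff)

text \<open>Repeated use of \<open>R\<close> carries a letter to the far end of a word; both the letter and the word
  change on the way, but no colour does.\<close>

lemma move_past: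
  assumes "x \<in> X" "u \<in> lists X"
  shows "\<exists>u' x'. u' \<in> lists X \<and> x' \<in> X \<and> map fst u' = map fst u \<and> fst x' = fst x
    \<and> (x # u, u' @ [x']) \<in> cong"
  using assms
proof (induction u arbitrary: x)
  case Nil
  then show ?case by (intro exI[of _ "[]"] exI[of _ x]) (auto intro: word_cong.refl)
next
  case (Cons y u)
  then have X: "x \<in> X" "y \<in> X" "u \<in> lists X" by auto
  obtain y' x' where R: "R (x, y) = (y', x')" "y' \<in> X" "x' \<in> X" "fst y' = fst y" "fst x' = fst x"
    using R_cases[OF X(1,2)] by metis
  obtain u'' x'' where u: "u'' \<in> lists X" "x'' \<in> X" "map fst u'' = map fst u" "fst x'' = fst x'"
    "(x' # u, u'' @ [x'']) \<in> cong"
    using Cons.IH[OF R(3) X(3)] by blast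
  have "(x # y # u, y' # u'' @ [x'']) \<in> cong"
    using cong_R[OF X(1,2) R(1) X(3)] cong_Cons[OF u(5) R(2)] by (rule word_cong.trans)
  then show ?case
    using R u by (intro exI[of _ "y' # u''"] exI[of _ x'']) auto
qed

text \<open>The existence half of the factorization property, by induction on the word. The first
  letter joins the left factor as long as the prescribed degree of that factor has room for its
  colour. Otherwise it belongs to the right factor and is moved past the left one.\<close>

lemma ex_splitting:
  assumes "w \<in> lists X" "word_degree w = (\<lambda>i. m i + n i)"
  shows "\<exists>u v. u \<in> lists X \<and> v \<in> lists X \<and> word_degree u = m \<and> word_degree v = n
    \<and> (w, u @ v) \<in> cong"
  using assms
proof (induction w arbitrary: m n rule: list.induct)
  case Nil
  then have "m = (\<lambda>i. 0)" "n = (\<lambda>i. 0)" by (auto simp: word_degree_simps fun_eq_iff)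
  then show ?case
    by (intro exI[of _ "[]"]) (auto simp: word_degree_simps intro: word_cong.refl)
next
  case (Cons x w)
  then have X: "x \<in> X" "w \<in> lists X" by auto
  have deg: "(if i = fst x then 1 else 0) + word_degree w i = m i + n i" for i
    using Cons.prems(2) by (simp add: word_degree_simps fun_eq_iff)
  show ?case
  proof (cases "m (fst x) = 0")
    case False
    have "word_degree w = (\<lambda>i. (m(fst x := m (fst x) - 1)) i + n i)"
    proof
      fix i show "word_degree w i = (m(fst x := m (fst x) - 1)) i + n i"
        using deg[of i] False by (cases "i = fst x") auto
    qed
    from Cons.IH[OF X(2) this] obtain u v where uv: "u \<in> lists X" "v \<in> lists X"
      "word_degree u = m(fst x := m (fst x) - 1)" "word_degree v = n" "(w, u @ v) \<in> cong"
      by blast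
    have "word_degree (x # u) = m"
      using False uv(3) by (auto simp: word_degree_simps)
    then show ?thesis
      using cong_Cons[OF uv(5) X(1)] uv X by (intro exI[of _ "x # u"] exI[of _ v]) auto
  next
    case True
    have n: "n (fst x) \<noteq> 0" using deg[of "fst x"] True by auto
    have "word_degree w = (\<lambda>i. m i + (n(fst x := n (fst x) - 1)) i)"
    proof
      fix i show "word_degree w i = m i + (n(fst x := n (fst x) - 1)) i"
        using deg[of i] True n by (cases "i = fst x") auto
    qed
    from Cons.IH[OF X(2) this] obtain u v where uv: "u \<in> lists X" "v \<in> lists X"
      "word_degree u = m" "word_degree v = n(fst x := n (fst x) - 1)" "(w, u @ v) \<in> cong"
      by blast
    obtain u' x' where u': "u' \<in> lists X" "x' \<in> X" "map fst u' = map fst u" "fst x' = fst x"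
      "(x # u, u' @ [x']) \<in> cong"
      using move_past[OF X(1) uv(1)] by blast
    have "(x # w, u' @ x' # v) \<in> cong"
      using word_cong.trans[OF cong_Cons[OF uv(5) X(1)]]
        word_cong_append[OF u'(5) word_cong.refl[OF uv(2)]] by simp
    moreover have "word_degree u' = m" using u' uv by (simp add: word_degree_def)
    moreover have "word_degree (x' # v) = n"
      using n uv(4) u'(4) by (auto simp: word_degree_simps)
    ultimately show ?thesis
      using u' uv by (intro exI[of _ u'] exI[of _ "x' # v"]) auto
  qed
qed

text \<open>The uniqueness half of the factorization property, stated for words: this is the bridge
  between \<open>k\<close>-graphs and the Yang--Baxter equation.\<close>

definition unique_splitting :: bool where
  "unique_splitting \<longleftrightarrow> (\<forall>u v u' v'. u \<in> lists X \<longrightarrow> v \<in> lists X \<longrightarrow> u' \<in> lists X \<longrightarrow> v' \<in> lists X \<longrightarrow>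
     word_degree u = word_degree u' \<longrightarrow> word_degree v = word_degree v' \<longrightarrow>
     (u @ v, u' @ v') \<in> cong \<longrightarrow> (u, u') \<in> cong \<and> (v, v') \<in> cong)"

lemma k_graph_if_unique_splitting:
  assumes k: "\<And>x. x \<in> X \<Longrightarrow> fst x \<in> {1..k}" and "unique_splitting"
  shows "k_graph k (one_object_cat (yb_semigroup X R)) theta_degree"
proof -
  let ?M = "presented_monoid X (yb_rels X R)"
  let ?C = "one_object_cat ?M"
  note M_simps = one_object_cat_def carrier_presented_monoid one_presented_monoid
    mult_presented_monoid theta_degree_cls
  interpret small_category ?C by (rule small_category_presented_monoid)
  have "k_graph k ?C theta_degree"
  proof
    show "countable (Mor ?C)"
      by (simp add: M_simps)
    show "theta_degree l \<in> nat_tuples k" if l: "l \<in> Mor ?C" for l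
    proof -
      obtain w where w: "w \<in> lists X" "l = cls w" using l by (auto simp: M_simps)
      have "word_degree w i = 0" if "i \<notin> {1..k}" for i
        using w(1) that k by (auto simp: word_degree_def count_list_0_iff)
      then show ?thesis using w by (simp add: M_simps nat_tuples_def)
    qed
    show "theta_degree (Idm ?C v) = (\<lambda>i. 0)" for v
      by (simp add: M_simps word_degree_simps)
    show "theta_degree (Cmp ?C f g) = (\<lambda>i. theta_degree f i + theta_degree g i)"
      if fg: "f \<in> Mor ?C" "g \<in> Mor ?C" for f g
    proof -
      obtain u v where "u \<in> lists X" "f = cls u" "v \<in> lists X" "g = cls v"
        using fg by (auto simp: M_simps)
      then show ?thesis by (simp add: M_simps word_degree_simps)
    qed
    fix l m n
    assume l: "l \<in> Mor ?C" and d: "theta_degree l = (\<lambda>i. m i + n i)"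
    obtain w where w: "w \<in> lists X" "l = cls w" using l by (auto simp: M_simps)
    obtain u v where uv: "u \<in> lists X" "v \<in> lists X" "word_degree u = m" "word_degree v = n"
      "(w, u @ v) \<in> cong"
      using ex_splitting[OF w(1), of m n] d w by (auto simp: M_simps)
    show "\<exists>!(f, g). f \<in> Mor ?C \<and> g \<in> Mor ?C \<and> Src ?C f = Rng ?C g
        \<and> theta_degree f = m \<and> theta_degree g = n \<and> l = Cmp ?C f g"
    proof (rule ex1I[of _ "(cls u, cls v)"])
      show "case (cls u, cls v) of (f, g) \<Rightarrow> f \<in> Mor ?C \<and> g \<in> Mor ?C \<and> Src ?C f = Rng ?C g
        \<and> theta_degree f = m \<and> theta_degree g = n \<and> l = Cmp ?C f g"
        using uv w word_class_eq_iff[OF w(1), of "u @ v"] by (auto simp: M_simps)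
    next
      fix p
      assume p: "case p of (f, g) \<Rightarrow> f \<in> Mor ?C \<and> g \<in> Mor ?C \<and> Src ?C f = Rng ?C g
        \<and> theta_degree f = m \<and> theta_degree g = n \<and> l = Cmp ?C f g"
      obtain u' v' where p': "p = (cls u', cls v')" "u' \<in> lists X" "v' \<in> lists X"
        using p by (auto simp: M_simps)
      have d': "word_degree u' = m" "word_degree v' = n" "cls w = cls (u' @ v')"
        using p p' w by (auto simp: M_simps)
      have "(w, u' @ v') \<in> cong"
        using d'(3) word_class_eq_iff[OF w(1), of "u' @ v'"] p' by auto
      then have "(u' @ v', u @ v) \<in> cong"
        using uv(5) by (blast intro: word_cong.trans word_cong.sym)
      then have "(u', u) \<in> cong \<and> (v', v) \<in> cong"
        using assms(2) uv p' d' unfolding unique_splitting_def by metis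
      then show "p = (cls u, cls v)"
        using p' uv by (simp add: word_class_eq_iff)
    qed
  qed
  then show ?thesis by (simp add: yb_semigroup_eq_presented)
qed

lemma unique_splitting_if_k_graph:
  assumes k: "\<And>x. x \<in> X \<Longrightarrow> fst x \<in> {1..k}"
    and "k_graph k (one_object_cat (yb_semigroup X R)) theta_degree"
  shows "unique_splitting"
proof -
  let ?M = "presented_monoid X (yb_rels X R)"
  let ?C = "one_object_cat ?M"
  note M_simps = one_object_cat_def carrier_presented_monoid one_presented_monoid
    mult_presented_monoid theta_degree_cls
  interpret k_graph k ?C theta_degree
    using assms(2) by (simp add: yb_semigroup_eq_presented)
  show ?thesis
    unfolding unique_splitting_def
  proof (intro allI impI)
    fix u v u' v'
    assume X: "u \<in> lists X" "v \<in> lists X" "u' \<in> lists X" "v' \<in> lists X"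
      and d: "word_degree u = word_degree u'" "word_degree v = word_degree v'"
      and c: "(u @ v, u' @ v') \<in> cong"
    have Mor: "cls w \<in> Mor ?C" if "w \<in> lists X" for w
      using that by (simp add: M_simps)
    have nt: "word_degree w \<in> nat_tuples k" if "w \<in> lists X" for w
      using deg_in[OF Mor[OF that]] that by (simp add: M_simps)
    have "theta_degree (cls (u @ v)) = (\<lambda>i. word_degree u i + word_degree v i)"
      using X by (simp add: M_simps word_degree_simps)
    from factorization[OF Mor nt[OF X(1)] nt[OF X(2)] this] X
    have ex1: "\<exists>!(f, g). f \<in> Mor ?C \<and> g \<in> Mor ?C \<and> Src ?C f = Rng ?C g
        \<and> theta_degree f = word_degree u \<and> theta_degree g = word_degree v
        \<and> cls (u @ v) = Cmp ?C f g" by simp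
    have "cls (u @ v) = cls (u' @ v')"
      using X c by (simp add: word_class_eq_iff)
    then have "(cls u, cls v) = (cls u', cls v')"
      using X d by (intro ex1[unfolded ex1_iff_ex_Uniq, THEN conjunct2, THEN Uniq_D]) (auto simp: M_simps)
    then show "(u, u') \<in> cong \<and> (v, v') \<in> cong"
      using X by (simp add: word_class_eq_iff)
  qed
qed

section \<open>Unique splitting and the Yang--Baxter equation\<close>

text \<open>Unique splitting compares the first letters and the remainders separately. First letters
  that are congruent as one-letter words are equal; induction handles the remainders.\<close>

lemma eq_if_cong_same_colours:
  assumes "unique_splitting" "(u, v) \<in> cong" "map fst u = map fst v"
  shows "u = v"
  using assms(2,3)
proof (induction u arbitrary: v rule: list.induct)
  case Nil
  then show ?case by simp
next
  case (Cons x u)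
  then obtain y w where v: "v = y # w" by (cases v) auto
  have X: "x # u \<in> lists X" "y # w \<in> lists X"
    using word_cong_in_lists Cons.prems(1) v by blast+
  have c: "fst x = fst y" "map fst u = map fst w" using Cons.prems(2) v by auto
  have "([x], [y]) \<in> cong \<and> (u, w) \<in> cong"
    using assms(1) X c Cons.prems(1) v unfolding unique_splitting_def
    by (elim allE[of _ "[x]"] allE[of _ u] allE[of _ "[y]"] allE[of _ w])
      (auto simp: word_degree_def)
  then show ?case using Cons.IH[of w] c v cong_short[of "[x]" "[y]"] by auto
qed

lemma bij_R: "bij_betw R (X \<times> X) (X \<times> X)"
proof -
  have involutive: "\<forall>p\<in>X \<times> X. R (R p) = p" by (auto intro: R_R)
  have closed: "R ` (X \<times> X) \<subseteq> X \<times> X" using R_closed by (metis SigmaE image_subsetI)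
  show ?thesis by (rule bij_betw_byWitness[OF involutive involutive closed closed])
qed

text \<open>Each application of \<open>R\<close> to neighbours replaces a word by a congruent one. Both sides of the
  equation reverse the colours of \<open>(x, y, z)\<close>, so they are congruent words of the same colours.\<close>

lemma yb_if_unique_splitting:
  assumes "unique_splitting"
  shows "yb_solution X R"
  unfolding yb_solution_def
proof (intro conjI ballI bij_R)
  fix p assume "p \<in> X \<times> X \<times> X"
  then obtain x y z where p: "p = (x, y, z)" and X: "x \<in> X" "y \<in> X" "z \<in> X" by auto
  obtain y1 x1 where 1: "R (x, y) = (y1, x1)" "y1 \<in> X" "x1 \<in> X" "fst y1 = fst y" "fst x1 = fst x"
    using R_cases[OF X(1,2)] by metis
  obtain z2 x2 where 2: "R (x1, z) = (z2, x2)" "z2 \<in> X" "x2 \<in> X" "fst z2 = fst z" "fst x2 = fst x1"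
    using R_cases[OF 1(3) X(3)] by metis
  obtain z3 y3 where 3: "R (y1, z2) = (z3, y3)" "z3 \<in> X" "y3 \<in> X" "fst z3 = fst z2" "fst y3 = fst y1"
    using R_cases[OF 1(2) 2(2)] by metis
  obtain z4 y4 where 4: "R (y, z) = (z4, y4)" "z4 \<in> X" "y4 \<in> X" "fst z4 = fst z" "fst y4 = fst y"
    using R_cases[OF X(2,3)] by metis
  obtain z5 x5 where 5: "R (x, z4) = (z5, x5)" "z5 \<in> X" "x5 \<in> X" "fst z5 = fst z4" "fst x5 = fst x"
    using R_cases[OF X(1) 4(2)] by metis
  obtain y6 x6 where 6: "R (x5, y4) = (y6, x6)" "y6 \<in> X" "x6 \<in> X" "fst y6 = fst y4" "fst x6 = fst x5"
    using R_cases[OF 5(3) 4(3)] by metis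
  \<comment> \<open>The left-hand side is reached through steps 1, 2, 3 and the right-hand side through steps 4, 5, 6.\<close>
  have "([x, y, z], [y1, x1, z]) \<in> cong" "([y1, x1, z], [y1, z2, x2]) \<in> cong"
    "([y1, z2, x2], [z3, y3, x2]) \<in> cong"
    using X 1 2 3 by (auto intro!: cong_R cong_Cons)
  then have l: "([x, y, z], [z3, y3, x2]) \<in> cong" by (blast intro: word_cong.trans)
  have "([x, y, z], [x, z4, y4]) \<in> cong" "([x, z4, y4], [z5, x5, y4]) \<in> cong"
    "([z5, x5, y4], [z5, y6, x6]) \<in> cong"
    using X 4 5 6 by (auto intro!: cong_R cong_Cons)
  then have "([x, y, z], [z5, y6, x6]) \<in> cong" by (blast intro: word_cong.trans)
  then have "([z3, y3, x2], [z5, y6, x6]) \<in> cong" using l by (blast intro: word_cong.trans word_cong.sym)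
  then have "[z3, y3, x2] = [z5, y6, x6]"
    using 1 2 3 4 5 6 by (intro eq_if_cong_same_colours[OF assms]) auto
  then show "act12 R (act23 R (act12 R p)) = act23 R (act12 R (act23 R p))"
    using 1 2 3 4 5 6 by (simp add: p act12_def act23_def)
qed

section \<open>Sorting words by colour\<close>

text \<open>One step of insertion sort. Exchanging two letters is done with \<open>R\<close>, so the letters change
  while the colours behave as in ordinary sorting. A letter stops in front of a letter of its own
  colour.\<close>

fun insert_letter :: "nat \<times> nat \<Rightarrow> (nat \<times> nat) list \<Rightarrow> (nat \<times> nat) list" where
  "insert_letter x [] = [x]"
| "insert_letter x (y # w) =
     (if fst x \<le> fst y then x # y # w
      else fst (R (x, y)) # insert_letter (snd (R (x, y))) w)"

definition colour_sort :: "(nat \<times> nat) list \<Rightarrow> (nat \<times> nat) list" where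
  "colour_sort w = foldr insert_letter w []"

lemma colour_sort_simps [simp]:
  "colour_sort [] = []"
  "colour_sort (x # w) = insert_letter x (colour_sort w)"
  by (simp_all add: colour_sort_def)

lemma insert_letter_in_lists:
  "\<lbrakk>x \<in> X; w \<in> lists X\<rbrakk> \<Longrightarrow> insert_letter x w \<in> lists X"
proof (induction w arbitrary: x)
  case (Cons y w)
  then show ?case using R_closed[of x y] by (auto simp: mem_Times_iff)
qed auto

lemma colour_sort_in_lists: "w \<in> lists X \<Longrightarrow> colour_sort w \<in> lists X"
  by (induction w) (auto simp: insert_letter_in_lists simp del: in_lists_conv_set)

lemma colours_insert_letter:
  "\<lbrakk>x \<in> X; w \<in> lists X\<rbrakk> \<Longrightarrow> map fst (insert_letter x w) = insort (fst x) (map fst w)"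
proof (induction w arbitrary: x)
  case (Cons y w)
  then show ?case using R_closed[of x y] fst_R[of x y] snd_R[of x y] by (auto simp: mem_Times_iff)
qed auto

lemma colours_colour_sort: "w \<in> lists X \<Longrightarrow> map fst (colour_sort w) = sort (map fst w)"
  by (induction w) (auto simp: colours_insert_letter colour_sort_in_lists simp del: in_lists_conv_set)

lemma cong_insert_letter:
  "\<lbrakk>x \<in> X; w \<in> lists X\<rbrakk> \<Longrightarrow> (x # w, insert_letter x w) \<in> cong"
proof (induction w arbitrary: x)
  case Nil
  then show ?case by (auto intro: word_cong.refl)
next
  case (Cons y w)
  then have X: "x \<in> X" "y \<in> X" "w \<in> lists X" by auto
  obtain y' x' where R: "R (x, y) = (y', x')" "y' \<in> X" "x' \<in> X"
    using R_cases[OF X(1,2)] by metis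
  show ?case
    using word_cong.trans[OF cong_R[OF X(1,2) R(1) X(3)] cong_Cons[OF Cons.IH[OF R(3) X(3)] R(2)]]
      R word_cong.refl[of "x # y # w"] X by auto
qed

lemma cong_colour_sort: "w \<in> lists X \<Longrightarrow> (w, colour_sort w) \<in> cong"
proof (induction w)
  case Nil
  then show ?case by (auto intro: word_cong.refl)
next
  case (Cons x w)
  then have "x \<in> X" "w \<in> lists X" by auto
  then show ?case
    using word_cong.trans[OF cong_Cons cong_insert_letter[OF _ colour_sort_in_lists]] Cons.IH
    by auto
qed

text \<open>The colours of \<open>x\<close> and \<open>u\<close> fix the path along which \<open>x\<close> travels, and each exchange on this
  path can be undone because \<open>R\<close> is involutive.\<close>

lemma insert_letter_inject:
  assumes "x \<in> X" "y \<in> X" "u \<in> lists X" "v \<in> lists X" "fst x = fst y" "map fst u = map fst v"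
    and "insert_letter x u = insert_letter y v"
  shows "x = y \<and> u = v"
  using assms
proof (induction u arbitrary: x y v)
  case Nil
  then show ?case by simp
next
  case (Cons a u)
  then obtain b w where v: "v = b # w" by (cases v) auto
  have X: "a \<in> X" "b \<in> X" "u \<in> lists X" "w \<in> lists X" using Cons.prems v by auto
  have c: "fst a = fst b" "map fst u = map fst w" using Cons.prems v by auto
  obtain a' x' where 1: "R (x, a) = (a', x')" "R (a', x') = (x, a)" "x' \<in> X" "fst x' = fst x"
    using R_cases[OF Cons.prems(1) X(1)] by metis
  obtain b' y' where 2: "R (y, b) = (b', y')" "R (b', y') = (y, b)" "y' \<in> X" "fst y' = fst y"
    using R_cases[OF Cons.prems(2) X(2)] by metis
  show ?case
  proof (cases "fst x \<le> fst a")
    case True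
    then show ?thesis using Cons.prems c v by auto
  next
    case False
    then have "a' = b'" "insert_letter x' u = insert_letter y' w"
      using Cons.prems(5,7) c(1) v 1(1) 2(1) by simp_all
    moreover from this have "x' = y' \<and> u = w"
      using 1(4) 2(4) Cons.prems(5) by (intro Cons.IH 1(3) 2(3) X(3,4) c(2)) simp_all
    ultimately have "(x, a) = (y, b)" "u = w" using 1(2) 2(2) by metis+
    then show ?thesis using v by simp
  qed
qed

text \<open>Sorting may identify words, but only words with different sequences of colours.\<close>

lemma colour_sort_inject:
  assumes "u \<in> lists X" "v \<in> lists X" "map fst u = map fst v" "colour_sort u = colour_sort v"
  shows "u = v"
  using assms
proof (induction u arbitrary: v rule: list.induct)
  case Nil
  then show ?case by simp
next
  case (Cons x u)
  then obtain y w where v: "v = y # w" by (cases v) auto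
  have X: "x \<in> X" "y \<in> X" "u \<in> lists X" "w \<in> lists X" using Cons.prems v by auto
  have c: "fst x = fst y" "map fst u = map fst w" using Cons.prems v by auto
  have "x = y \<and> colour_sort u = colour_sort w"
    using Cons.prems(4) X c v
    by (intro insert_letter_inject) (simp_all add: colour_sort_in_lists colours_colour_sort del: in_lists_conv_set)
  then show ?case using Cons.IH[OF X(3,4) c(2)] v by simp
qed

text \<open>The Yang--Baxter equation enters here. By induction on \<open>w\<close>, with first letter \<open>z\<close>: if \<open>z\<close>
  has a smaller colour than both \<open>x\<close> and \<open>y\<close>, both inserted letters pass \<open>z\<close>, and the equation at
  \<open>(x, y, z)\<close> says that the two ways of passing it produce the same leading letter and again two
  pairs related by \<open>R\<close>. Otherwise the letter of the smaller colour stops in front, and both sides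
  agree after a single exchange of \<open>y'\<close> and \<open>x'\<close>.\<close>

lemma insert_letter_exchange_less:
  assumes yb: "yb_solution X R"
    and "x \<in> X" "y \<in> X" "w \<in> lists X" "fst x < fst y" "R (x, y) = (y', x')"
  shows "insert_letter x (insert_letter y w) = insert_letter y' (insert_letter x' w)"
  using assms(2-)
proof (induction w arbitrary: x y y' x')
  case Nil
  then show ?case using R_closed[of x y] fst_R[of x y] snd_R[of x y] R_R[of x y] by auto
next
  case (Cons z w)
  then have X: "x \<in> X" "y \<in> X" "z \<in> X" "w \<in> lists X" by auto
  note R = Cons.prems(5)
  have R': "R (y', x') = (x, y)" "y' \<in> X" "x' \<in> X" "fst y' = fst y" "fst x' = fst x"
    using R_cases[OF X(1,2)] R by (metis Pair_inject)+
  obtain z1 x1 where 1: "R (x', z) = (z1, x1)" "z1 \<in> X" "x1 \<in> X" "fst z1 = fst z" "fst x1 = fst x'"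
    using R_cases[OF R'(3) X(3)] by metis
  obtain z2 y1 where 2: "R (y', z1) = (z2, y1)" "z2 \<in> X" "y1 \<in> X" "fst z2 = fst z1" "fst y1 = fst y'"
    using R_cases[OF R'(2) 1(2)] by metis
  obtain z4 y4 where 4: "R (y, z) = (z4, y4)" "z4 \<in> X" "y4 \<in> X" "fst z4 = fst z" "fst y4 = fst y"
    using R_cases[OF X(2,3)] by metis
  obtain z5 x5 where 5: "R (x, z4) = (z5, x5)" "z5 \<in> X" "x5 \<in> X" "fst z5 = fst z4" "fst x5 = fst x"
    using R_cases[OF X(1) 4(2)] by metis
  \<comment> \<open>\<open>(z2, y1, x1)\<close> arises when \<open>x\<close> and \<open>y\<close> are exchanged first, \<open>(z5, x5, y4)\<close> when they are not.\<close>
  have "act12 R (act23 R (act12 R (x, y, z))) = act23 R (act12 R (act23 R (x, y, z)))"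
    using yb X by (simp add: yb_solution_def)
  then have braid: "z5 = z2" "R (x5, y4) = (y1, x1)"
    using R 1 2 4 5 by (auto simp: act12_def act23_def split: prod.splits)
  show ?case
  proof (cases "fst z < fst x")
    case True
    have "insert_letter x5 (insert_letter y4 w) = insert_letter y1 (insert_letter x1 w)"
      using Cons.IH[OF 5(3) 4(3) X(4) _ braid(2)] 4 5 Cons.prems(4) by simp
    then show ?thesis
      using True Cons.prems(4) R' 1 2 4 5 braid by simp
  next
    case False
    then show ?thesis
      using Cons.prems(4) R' 4 by simp
  qed
qed

text \<open>Since \<open>R\<close> is involutive, the case of decreasing colours is the previous lemma with the roles
  of \<open>(x, y)\<close> and \<open>(y', x')\<close> interchanged.\<close>

lemma insert_letter_exchange:
  assumes "yb_solution X R" "x \<in> X" "y \<in> X" "w \<in> lists X" "R (x, y) = (y', x')"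
  shows "insert_letter x (insert_letter y w) = insert_letter y' (insert_letter x' w)"
proof -
  have R': "R (y', x') = (x, y)" "y' \<in> X" "x' \<in> X" "fst y' = fst y" "fst x' = fst x"
    using R_cases[OF assms(2,3)] assms(5) by (metis Pair_inject)+
  consider "fst x < fst y" | "fst y < fst x" | "fst x = fst y" by linarith
  then show ?thesis
  proof cases
    case 1
    then show ?thesis using insert_letter_exchange_less assms by blast
  next
    case 2
    then show ?thesis
      using insert_letter_exchange_less[OF assms(1) R'(2,3) assms(4) _ R'(1)] R' by simp
  next
    case 3
    then show ?thesis using R_same[OF assms(2,3)] assms(5) by simp
  qed
qed

lemma colour_sort_cong:
  assumes "yb_solution X R" "(u, v) \<in> cong"
  shows "colour_sort u = colour_sort v"
  using assms(2)
proof (induction rule: word_cong.induct)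
  case (rel u v a b)
  obtain x y y' x' where uv: "u = [x, y]" "v = [y', x']" "x \<in> X" "y \<in> X" "R (x, y) = (y', x')"
    using rel(1) by (rule yb_relsE)
  have "colour_sort (u @ b) = colour_sort (v @ b)"
    using insert_letter_exchange[OF assms(1) uv(3,4) colour_sort_in_lists[OF rel(5)] uv(5)] uv
    by simp
  then show ?case by (simp add: colour_sort_def)
qed auto

text \<open>Sorting \<open>u\<close> and \<open>v\<close> separately, rather than \<open>uv\<close>, keeps track of where the word is cut.
  Factors of equal degree have sorted forms with the same colours and the same length.\<close>

lemma unique_splitting_if_yb:
  assumes "yb_solution X R"
  shows "unique_splitting"
  unfolding unique_splitting_def
proof (intro allI impI)
  fix u v u' v'
  assume X: "u \<in> lists X" "v \<in> lists X" "u' \<in> lists X" "v' \<in> lists X"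
    and d: "word_degree u = word_degree u'" "word_degree v = word_degree v'"
    and c: "(u @ v, u' @ v') \<in> cong"
  let ?s = "colour_sort"
  have s: "(w, ?s w) \<in> cong" "?s w \<in> lists X" if "w \<in> lists X" for w
    using that by (simp_all add: cong_colour_sort colour_sort_in_lists del: in_lists_conv_set)
  have colours: "map fst (?s w) = map fst (?s w')"
    if "w \<in> lists X" "w' \<in> lists X" "word_degree w = word_degree w'" for w w'
    using that by (auto simp: colours_colour_sort word_degree_eq_iff intro: properties_for_sort
        simp del: in_lists_conv_set)
  have "(?s u @ ?s v, u @ v) \<in> cong" "(u' @ v', ?s u' @ ?s v') \<in> cong"
    using word_cong_append[OF s(1)[OF X(1)] s(1)[OF X(2)]]
      word_cong_append[OF s(1)[OF X(3)] s(1)[OF X(4)]] by (auto intro: word_cong.sym)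
  then have cs: "(?s u @ ?s v, ?s u' @ ?s v') \<in> cong"
    using c by (blast intro: word_cong.trans)
  have "?s u @ ?s v = ?s u' @ ?s v'"
    using colour_sort_inject[OF _ _ _ colour_sort_cong[OF assms cs]] word_cong_in_lists[OF cs]
      colours[OF X(1,3) d(1)] colours[OF X(2,4) d(2)] by simp
  moreover have "length (?s u) = length (?s u')"
    using colours[OF X(1,3) d(1)] by (metis length_map)
  ultimately have "?s u = ?s u'" "?s v = ?s v'" by simp_all
  then have "(?s u, u') \<in> cong" "(?s v, v') \<in> cong"
    using s(1)[OF X(3)] s(1)[OF X(4)] by (auto intro: word_cong.sym)
  then show "(u, u') \<in> cong \<and> (v, v') \<in> cong"
    using s(1)[OF X(1)] s(1)[OF X(2)] by (blast intro: word_cong.trans)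
qed

theorem k_graph_iff_yb_solution:
  assumes "\<And>x. x \<in> X \<Longrightarrow> fst x \<in> {1..k}"
  shows "k_graph k (one_object_cat (yb_semigroup X R)) theta_degree \<longleftrightarrow> yb_solution X R"
  using assms k_graph_if_unique_splitting unique_splitting_if_k_graph
    unique_splitting_if_yb yb_if_unique_splitting by blast

end

section \<open>The map attached to a family of bijections\<close>

lemma theta_R_same: "theta_R N \<theta> ((i, s), (i, t)) = ((i, s), (i, t))"
  by (simp add: theta_R_def)

lemma theta_R_less:
  "\<lbrakk>i < j; \<theta> i j (s, t) = (t', s')\<rbrakk> \<Longrightarrow> theta_R N \<theta> ((i, s), (j, t)) = ((j, t'), (i, s'))"
  by (simp add: theta_R_def)

lemma theta_R_greater:
  assumes "bij_betw (\<theta> i j) ({1..N i} \<times> {1..N j}) B" "i < j" "s \<in> {1..N i}" "t \<in> {1..N j}"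
    and "\<theta> i j (s, t) = (t', s')"
  shows "theta_R N \<theta> ((j, t'), (i, s')) = ((i, s), (j, t))"
proof -
  have "inv_into ({1..N i} \<times> {1..N j}) (\<theta> i j) (t', s') = (s, t)"
    using assms by (intro inv_into_f_eq) (auto simp: bij_betw_def)
  then show ?thesis using assms(2) by (simp add: theta_R_def)
qed

locale theta_family =
  fixes k :: nat
    and N :: "nat \<Rightarrow> nat"
    and \<theta> :: "nat \<Rightarrow> nat \<Rightarrow> nat \<times> nat \<Rightarrow> nat \<times> nat"
  assumes bij_theta: "\<And>i j. \<lbrakk>1 \<le> i; i < j; j \<le> k\<rbrakk>
           \<Longrightarrow> bij_betw (\<theta> i j) ({1..N i} \<times> {1..N j}) ({1..N j} \<times> {1..N i})"
begin

abbreviation X :: "(nat \<times> nat) set" where "X \<equiv> theta_carrier k N"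

abbreviation R :: "(nat \<times> nat) \<times> (nat \<times> nat) \<Rightarrow> (nat \<times> nat) \<times> (nat \<times> nat)" where
  "R \<equiv> theta_R N \<theta>"

text \<open>In the last two cases \<open>\<theta> i j (s, t) = (t', s')\<close> with \<open>i < j\<close>; they differ in whether
  \<open>(x, y)\<close> is the argument or the value. Since \<open>R\<close> undoes itself in each case, all properties of
  \<open>R\<close> can be read off from here without mentioning inverse functions.\<close>

lemma theta_R_cases:
  assumes "x \<in> X" "y \<in> X"
  obtains (same) i s t where "x = (i, s)" "y = (i, t)" "R (x, y) = (x, y)"
  | (less) i j s t s' t' where "x = (i, s)" "y = (j, t)" "1 \<le> i" "i < j" "j \<le> k"
      "s \<in> {1..N i}" "t \<in> {1..N j}" "s' \<in> {1..N i}" "t' \<in> {1..N j}" "\<theta> i j (s, t) = (t', s')"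
      "R (x, y) = ((j, t'), (i, s'))" "R ((j, t'), (i, s')) = (x, y)"
  | (greater) i j s t s' t' where "x = (j, t')" "y = (i, s')" "1 \<le> i" "i < j" "j \<le> k"
      "s \<in> {1..N i}" "t \<in> {1..N j}" "s' \<in> {1..N i}" "t' \<in> {1..N j}" "\<theta> i j (s, t) = (t', s')"
      "R (x, y) = ((i, s), (j, t))" "R ((i, s), (j, t)) = (x, y)"
proof -
  obtain i s j t where xy: "x = (i, s)" "y = (j, t)" by fastforce
  have mem: "i \<in> {1..k}" "j \<in> {1..k}" "s \<in> {1..N i}" "t \<in> {1..N j}"
    using assms xy by (auto simp: theta_carrier_def)
  consider "i = j" | "i < j" | "j < i" by linarith
  then show thesis
  proof cases
    case 1
    then show thesis using xy theta_R_same by (intro same) auto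
  next
    case 2
    obtain t' s' where th: "\<theta> i j (s, t) = (t', s')" by fastforce
    have bij: "bij_betw (\<theta> i j) ({1..N i} \<times> {1..N j}) ({1..N j} \<times> {1..N i})"
      using bij_theta mem 2 by simp
    have m: "t' \<in> {1..N j}" "s' \<in> {1..N i}"
      using bij_betwE[OF bij, rule_format, of "(s, t)"] th mem(3,4) by auto
    have "R (x, y) = ((j, t'), (i, s'))" "R ((j, t'), (i, s')) = (x, y)"
      unfolding xy using theta_R_less[of i j \<theta> s t t' s' N, OF 2 th]
        theta_R_greater[of \<theta> i j N _ s t t' s', OF bij 2 mem(3,4) th] by blast+
    then show thesis
      using mem(1,2) 2 by (intro less[OF xy _ 2 _ mem(3,4) m(2,1) th]) simp_all
  next
    case 3
    have bij: "bij_betw (\<theta> j i) ({1..N j} \<times> {1..N i}) ({1..N i} \<times> {1..N j})"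
      using bij_theta mem 3 by simp
    have "(s, t) \<in> \<theta> j i ` ({1..N j} \<times> {1..N i})"
      using bij_betw_imp_surj_on[OF bij] mem(3,4) by simp
    then obtain t' s' where m: "t' \<in> {1..N j}" "s' \<in> {1..N i}" and th: "\<theta> j i (t', s') = (s, t)"
      by (elim imageE SigmaE) simp
    have "R (x, y) = ((j, t'), (i, s'))" "R ((j, t'), (i, s')) = (x, y)"
      unfolding xy using theta_R_less[of j i \<theta> t' s' s t N, OF 3 th]
        theta_R_greater[of \<theta> j i N _ t' s' s t, OF bij 3 m th] by blast+
    then show thesis
      using mem(1,2) 3 by (intro greater[OF xy _ 3 _ m(1,2) mem(4,3) th]) simp_all
  qed
qed

lemma mem_X_iff: "(i, s) \<in> X \<longleftrightarrow> i \<in> {1..k} \<and> s \<in> {1..N i}"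
  by (auto simp: theta_carrier_def)

sublocale colour_exchange X R
proof
  fix x y assume X: "x \<in> X" "y \<in> X"
  show "R (x, y) \<in> X \<times> X"
    using X by (cases rule: theta_R_cases[OF X]) (simp_all add: mem_X_iff)
  show "fst (fst (R (x, y))) = fst y"
    by (cases rule: theta_R_cases[OF X]) simp_all
  show "fst (snd (R (x, y))) = fst x"
    by (cases rule: theta_R_cases[OF X]) simp_all
  show "R (R (x, y)) = (x, y)"
    by (cases rule: theta_R_cases[OF X]) simp_all
  show "R (x, y) = (x, y)" if "fst x = fst y"
    using that by (cases rule: theta_R_cases[OF X]) simp_all
qed

text \<open>The two sets of relations differ, but only by trivial relations and reversed ones, so they
  generate the same congruence. The monoids are therefore equal, not merely isomorphic.\<close>

lemma theta_semigroup_eq_yb_semigroup: "theta_semigroup k N \<theta> = yb_semigroup X R"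
proof -
  let ?r = "{([(i, s), (j, t)], [(j, t'), (i, s')]) | i j s t t' s'.
    1 \<le> i \<and> i < j \<and> j \<le> k \<and> s \<in> {1..N i} \<and> t \<in> {1..N j} \<and> \<theta> i j (s, t) = (t', s')}"
  have base: "(u, v) \<in> word_cong X r" if "(u, v) \<in> r" "u \<in> lists X" "v \<in> lists X" for u v r
    using word_cong.rel[OF that, of "[]" "[]"] by simp
  have "word_cong X ?r \<subseteq> word_cong X (yb_rels X R)"
  proof (rule word_cong_mono)
    fix u v assume uv: "(u, v) \<in> ?r" "u \<in> lists X" "v \<in> lists X"
    then have "(u, v) \<in> yb_rels X R" by (auto simp: theta_R_less intro!: yb_relsI)
    then show "(u, v) \<in> word_cong X (yb_rels X R)" using uv(2,3) by (rule base)
  qed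
  moreover have "word_cong X (yb_rels X R) \<subseteq> word_cong X ?r"
  proof (rule word_cong_mono)
    fix u v assume uv: "(u, v) \<in> yb_rels X R" "u \<in> lists X" "v \<in> lists X"
    obtain x y y' x' where xy: "u = [x, y]" "v = [y', x']" "R (x, y) = (y', x')"
      and X: "x \<in> X" "y \<in> X" using uv(1) by (rule yb_relsE)
    from X show "(u, v) \<in> word_cong X ?r"
    proof (cases rule: theta_R_cases)
      case same
      then have "u = v" using xy by simp
      then show ?thesis using word_cong.refl[OF uv(2)] by simp
    next
      case (less i j s t s' t')
      then have "u = [(i, s), (j, t)]" "v = [(j, t'), (i, s')]" using xy by simp_all
      then have "(u, v) \<in> ?r" using less(3-10) by blast
      then show ?thesis using uv(2,3) by (rule base)
    next
      case (greater i j s t s' t')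
      then have "v = [(i, s), (j, t)]" "u = [(j, t'), (i, s')]" using xy by simp_all
      then have "(v, u) \<in> ?r" using greater(3-10) by blast
      then have "(v, u) \<in> word_cong X ?r" using uv(3,2) by (rule base)
      then show ?thesis by (rule word_cong.sym)
    qed
  qed
  ultimately have "word_cong X ?r = word_cong X (yb_rels X R)" by (rule equalityI)
  then show ?thesis
    unfolding theta_semigroup_def yb_semigroup_eq_presented presented_monoid_def by simp
qed

text \<open>The letters \<open>(i, 1)\<close> and \<open>(i, 2)\<close> are distinct, but with second argument \<open>(i, 1)\<close> both give
  the second component \<open>(i, 1)\<close>.\<close>

lemma yb_degenerate_theta_R:
  assumes "i \<in> {1..k}" "N i > 1"
  shows "yb_degenerate X R"
proof -
  have "(i, 1) \<in> X" "(i, 2) \<in> X" using assms by (auto simp: mem_X_iff)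
  moreover have "snd (R ((i, 1), (i, 1))) = snd (R ((i, 2), (i, 1)))"
    by (simp add: theta_R_same)
  ultimately have "\<not> inj_on (\<lambda>x. snd (R (x, (i, 1)))) X"
    using inj_onD[of "\<lambda>x. snd (R (x, (i, 1)))" X "(i, 1)" "(i, 2)"] by auto
  then show ?thesis
    using \<open>(i, 1) \<in> X\<close> unfolding yb_degenerate_def yb_nondegenerate_def bij_betw_def by blast
qed

end

theorem theorem4p15:
  fixes k :: nat
    and N :: "nat \<Rightarrow> nat"
    and \<theta> :: "nat \<Rightarrow> nat \<Rightarrow> nat \<times> nat \<Rightarrow> nat \<times> nat"
  assumes "k \<ge> 3"
    and "\<And>i. i \<in> {1..k} \<Longrightarrow> N i \<ge> 1"
    and "\<And>i j. \<lbrakk>1 \<le> i; i < j; j \<le> k\<rbrakk>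
           \<Longrightarrow> bij_betw (\<theta> i j) ({1..N i} \<times> {1..N j}) ({1..N j} \<times> {1..N i})"
  shows "(determines_k_graph k N \<theta> \<longleftrightarrow> yb_solution (theta_carrier k N) (theta_R N \<theta>))
    \<and> theta_semigroup k N \<theta> \<cong> yb_semigroup (theta_carrier k N) (theta_R N \<theta>)
    \<and> yb_involutive (theta_carrier k N) (theta_R N \<theta>)
    \<and> yb_square_free (theta_carrier k N) (theta_R N \<theta>)
    \<and> (\<not> (\<forall>i\<in>{1..k}. N i = 1) \<longrightarrow> yb_degenerate (theta_carrier k N) (theta_R N \<theta>))"
proof -
  interpret theta_family k N \<theta>
    by unfold_locales (rule assms(3))
  have "single_vertex (one_object_cat M)" for M :: "(nat \<times> nat) list set monoid"
    by (simp add: single_vertex_def one_object_cat_def)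
  then have "determines_k_graph k N \<theta> \<longleftrightarrow> yb_solution X R"
    unfolding determines_k_graph_def theta_semigroup_eq_yb_semigroup
    using k_graph_iff_yb_solution[of k] by (force simp: theta_carrier_def)
  moreover have "theta_semigroup k N \<theta> \<cong> yb_semigroup X R"
    unfolding theta_semigroup_eq_yb_semigroup by (rule iso_refl)
  moreover have "yb_involutive X R"
    unfolding yb_involutive_def using R_R by auto
  moreover have "yb_square_free X R"
    unfolding yb_square_free_def using R_same by auto
  moreover have "yb_degenerate X R" if not_all_one: "\<not> (\<forall>i\<in>{1..k}. N i = 1)"
  proof -
    obtain i where "i \<in> {1..k}" "N i \<noteq> 1" using not_all_one by blast
    then show ?thesis using assms(2)[of i] by (intro yb_degenerate_theta_R[of i]) auto
  qed
  ultimately show ?thesis by blast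
qed

end
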